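(* Let $\alpha=\alpha_1\times\dots\times\alpha_s=B_1^{d_1}\times\dots\times B_s^{d_s}$ be a rectangular arity, put $d:=d_1+\dots+d_s$, and let $\rho\subseteq A^{\alpha}$ be a ($d$-dimensional) weak generalized quasiorder. Then the property $\Xi^{\mathrm w}_d(\rho)$ holds, i.e. for every operation $f\in\mathrm{Op}(A)$: $f$ preserves $\rho$ if and only if every operation in $\mathrm{trl}^{\mathrm{Im}\,\rho}_d(f)$ preserves $\rho$. If $\rho$ is a generalized quasiorder, then the property $\Xi_d(\rho)$ holds, i.e. for every $f\in\mathrm{Op}(A)$: $f$ preserves $\rho$ if and only if every operation in $\mathrm{trl}_d(f)$ preserves $\rho$.
   Context: Standing assumptions: $A$ is a finite nonempty set; all sets $B,B_i$ are finite and nonempty; $\mathbb N=\{0,1,2,\dots\}$. $\mathrm{Op}(A)$ is the set of all operations $f:A^n\to A$ with $n\ge 1$. Elementary translations. For $h:B^{n+1}\to A$, $\mathrm{ebtrl}(h)$ is the set of all functions $(x_0,\dots,x_{n-1})\mapsto h(x_0,\dots,x_{i-1},c,x_i,\dots,x_{n-1})$ with $0\le i\le n$, $c\in B$; for nullary $h$, $\mathrm{ebtrl}(h)=\emptyset$. For $g:B^n\to A$, $\mathrm{eftrl}(g)$ consists of the two functions $(x_0,\dots,x_n)\mapsto g(x_1,\dots,x_n)$ and $(x_0,\dots,x_n)\mapsto g(x_0,\dots,x_{n-1})$. Both are extended to sets of functions by unions. Simple arity. For $\rho\subseteq A^{B^d}$ (a set of functions $B^d\to A$) put $\circledast(\rho):=\{h\in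 A^{B^{d+1}}\mid \mathrm{ebtrl}(h)\subseteq\rho\}$. For $h\in A^{B^{d+1}}$, $\mathbf\Delta(h)$ is the set of all functions $(x_0,\dots,x_{d-1})\mapsto h(x_0,\dots,x_{j-1},x_i,x_j,\dots,x_{d-1})$ with $0\le i<j\le d$; extended to sets by unions. $\rho$ is internally reflexive if $\mathrm{eftrl}(\rho)\subseteq\circledast(\rho)$, and transitive if $\mathbf\Delta(\circledast(\rho))\subseteq\rho$. General (compound) arity. An R-relation of rectangular arity $\alpha=\alpha_1\times\dots\times\alpha_s$, $\alpha_j=B_j^{d_j}$ ($s\ge1$, $d_j\ge 0$), is a set $\rho\subseteq A^{\alpha}$ of functions $\alpha\to A$; its dimension is $d_1+\dots+d_s$. Let $\alpha/\alpha_j$ be the product with the $j$-th factor deleted (a one-point set if $s=1$). For $g\in A^\alpha$ let $g^{(\alpha_j)}:\alpha_j\to A^{\alpha/\alpha_j}$ be its currying, $g^{(\alpha_j)}(X_j)(X_1,\dots,X_{j-1},X_{j+1},\dots,X_s)=g(X_1,\dots,X_s)$, and $\rho^{(\alpha_j)}:=\{g^{(\alpha_j)}\mid g\in\rho\}$, a relation of simple arity $\alpha_j=B_j^{d_j}$ over the base set $A^{\alpha/\alpha_j}$. $\rho$ is internally reflexive (transitive) if every $\rho^{(\alpha_j)}$, $1\le j\le s$, is internally reflexive (transitive). $\rho$ is a weak generalized quasiorder if it is internally reflexive and transitive; it is reflexive if it is internally reflexive and contains every constant function $\alpha\to A$; it is a generalized quasiorder if it is reflexive and transitive. Preservation: $f:A^n\to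 A$ preserves $\rho\subseteq A^\alpha$ if for all $g_1,\dots,g_n\in\rho$ the function $b\mapsto f(g_1(b),\dots,g_n(b))$ is in $\rho$ (a nullary operation with value $a$ preserves $\rho$ iff the constant function with value $a$ is in $\rho$). $\mathrm{Im}\,\rho:=\bigcup_{g\in\rho}\mathrm{Im}\, g\subseteq A$. Translations of operations. For $K\subseteq A$ and $f:A^n\to A$, $\mathrm{trl}^K_d(f)$ is the set of all $d$-ary operations obtained from $f$ by substituting constants from $K$ for some (possibly none, possibly all) of its variables, keeping the remaining $t\le d$ variables in their order, and then prepending $u$ and appending $v$ fictitious variables, where $u+t+v=d$. $\mathrm{trl}_d(f):=\mathrm{trl}_d^A(f)$. *)

theory Defs
  imports "HOL-Library.FuncSet" "HOL-Library.NList"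
begin

text \<open>
  The power $B^n$ is the set \<open>nlists n B\<close> of lists of length \<open>n\<close> over \<open>B\<close>, and $A^X$ is the set
  \<open>X \<rightarrow>\<^sub>E A\<close> of extensional functions. All indices start at 0.
\<close>


subsection \<open>Relations of simple arity\<close>

text \<open>
  Here \<open>C\<close> is the base set (which will not always be the set \<open>A\<close> of the compound relation,
  but also a set of functions into it).
\<close>

definition ebtrl :: "'b set \<Rightarrow> nat \<Rightarrow> ('b list \<Rightarrow> 'c) \<Rightarrow> ('b list \<Rightarrow> 'c) set"
  where \<comment> \<open>\<open>n\<close> is the arity of \<open>h\<close>\<close>
  "ebtrl B n h =
    {(\<lambda>xs\<in>nlists (n - 1) B. h (take i xs @ c # drop i xs)) | i c. i < n \<and> c \<in> B}"

definition eftrl :: "'b set \<Rightarrow> nat \<Rightarrow> ('b list \<Rightarrow> 'c) \<Rightarrow> ('b list \<Rightarrow> 'c) set"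
  where \<comment> \<open>\<open>n\<close> is the arity of \<open>g\<close>\<close>
  "eftrl B n g =
    {(\<lambda>xs\<in>nlists (Suc n) B. g (tl xs)), (\<lambda>xs\<in>nlists (Suc n) B. g (butlast xs))}"

definition ostar ::
    "'c set \<Rightarrow> 'b set \<Rightarrow> nat \<Rightarrow> ('b list \<Rightarrow> 'c) set \<Rightarrow> ('b list \<Rightarrow> 'c) set"
  where "ostar C B d \<rho> = {h \<in> nlists (Suc d) B \<rightarrow>\<^sub>E C. ebtrl B (Suc d) h \<subseteq> \<rho>}"

definition Deltas :: "'b set \<Rightarrow> nat \<Rightarrow> ('b list \<Rightarrow> 'c) \<Rightarrow> ('b list \<Rightarrow> 'c) set"
  where \<comment> \<open>\<open>h\<close> has arity \<open>Suc d\<close>\<close>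
  "Deltas B d h =
    {(\<lambda>xs\<in>nlists d B. h (take j xs @ xs ! i # drop j xs)) | i j. i < j \<and> j \<le> d}"

definition simple_internally_reflexive ::
    "'c set \<Rightarrow> 'b set \<Rightarrow> nat \<Rightarrow> ('b list \<Rightarrow> 'c) set \<Rightarrow> bool"
  where "simple_internally_reflexive C B d \<rho> \<longleftrightarrow> (\<Union>g\<in>\<rho>. eftrl B d g) \<subseteq> ostar C B d \<rho>"

definition simple_transitive ::
    "'c set \<Rightarrow> 'b set \<Rightarrow> nat \<Rightarrow> ('b list \<Rightarrow> 'c) set \<Rightarrow> bool"
  where "simple_transitive C B d \<rho> \<longleftrightarrow> (\<Union>h\<in>ostar C B d \<rho>. Deltas B d h) \<subseteq> \<rho>"


subsection \<open>Relations of compound arity\<close>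

text \<open>
  A rectangular arity $B_1^{d_1} \times \dots \times B_s^{d_s}$ is the list of the pairs
  $(B_j, d_j)$. The sets $B_j$ are arbitrary subsets of one common type, which is no restriction
  as there are only finitely many of them.
\<close>

type_synonym 'b arity = "('b set \<times> nat) list"

definition rect :: "'b arity \<Rightarrow> 'b list list set"
  where "rect \<alpha> = listset (map (\<lambda>(B, d). nlists d B) \<alpha>)"

definition dimension :: "'b arity \<Rightarrow> nat"
  where "dimension \<alpha> = sum_list (map snd \<alpha>)"

definition del_factor :: "'b arity \<Rightarrow> nat \<Rightarrow> 'b arity"
  where "del_factor \<alpha> j = take j \<alpha> @ drop (Suc j) \<alpha>"

definition curry_at ::
    "'b arity \<Rightarrow> nat \<Rightarrow> ('b list list \<Rightarrow> 'a) \<Rightarrow> 'b list \<Rightarrow> 'b list list \<Rightarrow> 'a"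
  where "curry_at \<alpha> j g =
    (\<lambda>X\<in>nlists (snd (\<alpha> ! j)) (fst (\<alpha> ! j)).
      \<lambda>Y\<in>rect (del_factor \<alpha> j). g (take j Y @ X # drop j Y))"

definition internally_reflexive ::
    "'a set \<Rightarrow> 'b arity \<Rightarrow> ('b list list \<Rightarrow> 'a) set \<Rightarrow> bool"
  where "internally_reflexive A \<alpha> \<rho> \<longleftrightarrow>
    (\<forall>j < length \<alpha>. simple_internally_reflexive (rect (del_factor \<alpha> j) \<rightarrow>\<^sub>E A)
      (fst (\<alpha> ! j)) (snd (\<alpha> ! j)) (curry_at \<alpha> j ` \<rho>))"

definition transitive ::
    "'a set \<Rightarrow> 'b arity \<Rightarrow> ('b list list \<Rightarrow> 'a) set \<Rightarrow> bool"
  where "transitive A \<alpha> \<rho> \<longleftrightarrow>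
    (\<forall>j < length \<alpha>. simple_transitive (rect (del_factor \<alpha> j) \<rightarrow>\<^sub>E A)
      (fst (\<alpha> ! j)) (snd (\<alpha> ! j)) (curry_at \<alpha> j ` \<rho>))"

definition weak_generalized_quasiorder ::
    "'a set \<Rightarrow> 'b arity \<Rightarrow> ('b list list \<Rightarrow> 'a) set \<Rightarrow> bool"
  where "weak_generalized_quasiorder A \<alpha> \<rho> \<longleftrightarrow>
    internally_reflexive A \<alpha> \<rho> \<and> transitive A \<alpha> \<rho>"

definition reflexive ::
    "'a set \<Rightarrow> 'b arity \<Rightarrow> ('b list list \<Rightarrow> 'a) set \<Rightarrow> bool"
  where "reflexive A \<alpha> \<rho> \<longleftrightarrow>
    internally_reflexive A \<alpha> \<rho> \<and> (\<forall>a\<in>A. (\<lambda>X\<in>rect \<alpha>. a) \<in> \<rho>)"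

definition generalized_quasiorder ::
    "'a set \<Rightarrow> 'b arity \<Rightarrow> ('b list list \<Rightarrow> 'a) set \<Rightarrow> bool"
  where "generalized_quasiorder A \<alpha> \<rho> \<longleftrightarrow> reflexive A \<alpha> \<rho> \<and> transitive A \<alpha> \<rho>"

definition Im_rel :: "'b arity \<Rightarrow> ('b list list \<Rightarrow> 'a) set \<Rightarrow> 'a set"
  where "Im_rel \<alpha> \<rho> = (\<Union>g\<in>\<rho>. g ` rect \<alpha>)"


subsection \<open>Operations, preservation and translations\<close>

definition ops :: "'a set \<Rightarrow> nat \<Rightarrow> ('a list \<Rightarrow> 'a) set"
  where "ops A n = (nlists n A \<rightarrow>\<^sub>E A)"

definition preserves ::
    "nat \<Rightarrow> ('a list \<Rightarrow> 'a) \<Rightarrow> 'b arity \<Rightarrow> ('b list list \<Rightarrow> 'a) set \<Rightarrow> bool"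
  where "preserves n f \<alpha> \<rho> \<longleftrightarrow>
    (\<forall>gs\<in>nlists n \<rho>. (\<lambda>X\<in>rect \<alpha>. f (map (\<lambda>g. g X) gs)) \<in> \<rho>)"

text \<open>
  A pattern \<open>ps\<close> says what is put into each argument position of an operation: \<open>Some c\<close> stands
  for the constant \<open>c\<close>, and \<open>None\<close> for the next remaining variable.
\<close>

fun fill :: "'a option list \<Rightarrow> 'a list \<Rightarrow> 'a list"
  where
    "fill [] xs = []"
  | "fill (Some c # ps) xs = c # fill ps xs"
  | "fill (None # ps) xs = hd xs # fill ps (tl xs)"

definition trl ::
    "'a set \<Rightarrow> 'a set \<Rightarrow> nat \<Rightarrow> nat \<Rightarrow> ('a list \<Rightarrow> 'a) \<Rightarrow> ('a list \<Rightarrow> 'a) set"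
  where \<comment> \<open>\<open>n\<close> is the arity of \<open>f\<close>, \<open>d\<close> that of the translations\<close>
  "trl A K d n f =
    {(\<lambda>xs\<in>nlists d A. f (fill ps (take t (drop u xs)))) | ps u t v.
      ps \<in> nlists n (insert None (Some ` K)) \<and> t = count_list ps None \<and> u + t + v = d}"

definition Xi_w :: "'a set \<Rightarrow> 'b arity \<Rightarrow> nat \<Rightarrow> ('b list list \<Rightarrow> 'a) set \<Rightarrow> bool"
  where "Xi_w A \<alpha> d \<rho> \<longleftrightarrow>
    (\<forall>n\<ge>1. \<forall>f\<in>ops A n.
      preserves n f \<alpha> \<rho> \<longleftrightarrow> (\<forall>f'\<in>trl A (Im_rel \<alpha> \<rho>) d n f. preserves d f' \<alpha> \<rho>))"

definition Xi :: "'a set \<Rightarrow> 'b arity \<Rightarrow> nat \<Rightarrow> ('b list list \<Rightarrow> 'a) set \<Rightarrow> bool"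
  where "Xi A \<alpha> d \<rho> \<longleftrightarrow>
    (\<forall>n\<ge>1. \<forall>f\<in>ops A n.
      preserves n f \<alpha> \<rho> \<longleftrightarrow> (\<forall>f'\<in>trl A A d n f. preserves d f' \<alpha> \<rho>))"

end

theory Submission
  imports Defs
begin

text \<open>If a translation of \<open>f\<close> is applied to members of \<rho>, the result is
  \<open>f\<close> applied to members of \<rho> and to constant functions. In a generalized
  quasiorder all constants do. In a weak one those with values in Im \<rho> do: substituting the
  coordinates of a point \<open>Z\<close> for all variables of a member \<open>g\<close> gives the
  constant \<open>g Z\<close> (\<open>constant_in_relation\<close>).

  For the converse take g_1, ..., g_n in \<rho> and give each operand its own copy of the variables,
  that is, consider f(g_1(X^1), ..., g_n(X^n)). Replace variables by constants so that exactly d_j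
  of the n * d_j variables of factor j are left. Then d variables remain in all, so at most d
  operands are not constant. By internal reflexivity each operand, read as a function on \<alpha>,
  is still in \<rho> (\<open>internally_reflexive_fill\<close>), and constant operands have values
  in Im \<rho>. The whole function is thus a translation of \<open>f\<close> applied to members of
  \<rho> (\<open>compose_few_nonconstant\<close>) and lies in \<rho>.

  Transitivity leads from these partial substitutions to the function in which all copies are
  identified: if every way of fixing one of d + 1 variables leads into \<rho>, so does identifying
  two of them. Applied repeatedly, this gives \<open>simple_transitive_periodic\<close> for one
  factor, and through currying \<open>transitive_periodic\<close> for all factors. The two halves
  meet in \<open>preserves_if_trl_preserves\<close>.\<close>

text \<open>
  As simplification rules, these two make the simplifier loop once membership in \<^const>\<open>nlists\<close> is
  unfolded.
\<close>
declare nlistsE_length [simp del] nlistsE_set [simp del]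

section \<open>Patterns: substitution of constants for some variables\<close>

text \<open>Here patterns act on the arguments of members of a relation, with constants from a base
  set \<open>B\<close>; \<open>trl\<close> uses the same kind of words for the arguments of an
  operation. The number \<open>t\<close> of variables is recorded because the inductions run over it
  or keep it fixed.\<close>

definition patterns :: "nat \<Rightarrow> nat \<Rightarrow> 'b set \<Rightarrow> 'b option list set"
  where "patterns n t B = {ps \<in> nlists n (insert None (Some ` B)). count_list ps None = t}"

lemma patterns_iff:
  "ps \<in> patterns n t B \<longleftrightarrow>
    length ps = n \<and> set ps \<subseteq> insert None (Some ` B) \<and> count_list ps None = t"
  by (simp add: patterns_def nlists_def)

lemma length_fill [simp]: "length (fill ps xs) = length ps"
  by (induction ps xs rule: fill.induct) auto

lemma fill_append:
  "fill (ps @ qs) xs = fill ps xs @ fill qs (drop (count_list ps None) xs)"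
  by (induction ps xs rule: fill.induct) (auto simp: drop_Suc)

lemma take_fill: "take m (fill ps xs) = fill (take m ps) xs"
proof -
  have "fill ps xs = fill (take m ps @ drop m ps) xs" by simp
  then show ?thesis unfolding fill_append by (cases "m \<le> length ps") (auto simp: min_def)
qed

lemma drop_fill:
  "drop m (fill ps xs) = fill (drop m ps) (drop (count_list (take m ps) None) xs)"
proof -
  have "fill ps xs = fill (take m ps @ drop m ps) xs" by simp
  then show ?thesis unfolding fill_append by (cases "m \<le> length ps") (auto simp: min_def)
qed

lemma fill_take: "count_list ps None \<le> n \<Longrightarrow> fill ps (take n xs) = fill ps xs"
proof (induction ps xs arbitrary: n rule: fill.induct)
  case (3 ps xs)
  then show ?case by (cases n; cases xs) auto
qed auto

lemma fill_append_arg: "length xs = count_list ps None \<Longrightarrow> fill ps (xs @ ys) = fill ps xs"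
  using fill_take[of ps "length xs" "xs @ ys"] by simp

lemma fill_no_variable: "count_list ps None = 0 \<Longrightarrow> fill ps xs = fill ps ys"
  using fill_take[of ps 0 xs] fill_take[of ps 0 ys] by simp

lemma fill_map_Some [simp]: "fill (map Some xs) ys = xs"
  by (induction xs) auto

lemma fill_replicate_None: "length xs = n \<Longrightarrow> fill (replicate n None) xs = xs"
proof (induction n arbitrary: xs)
  case (Suc n)
  then show ?case by (cases xs) auto
qed simp

lemma count_list_replicate [simp]: "count_list (replicate n x) x = n"
  by (induction n) auto

lemma replicate_None_in_patterns [simp]: "replicate d None \<in> patterns d d B"
  by (auto simp: patterns_iff)

lemma patterns_full:
  assumes "ps \<in> patterns d d B"
  shows "ps = replicate d None"
proof -
  have "count_list ps None = length ps \<Longrightarrow> ps = replicate (length ps) None"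
  proof (induction ps)
    case (Cons p ps)
    then show ?case using count_le_length[of ps None] by (auto split: if_splits)
  qed simp
  then show ?thesis using assms by (simp add: patterns_iff)
qed

lemma set_fill_subset:
  "count_list ps None \<le> length xs \<Longrightarrow> set (fill ps xs) \<subseteq> {c. Some c \<in> set ps} \<union> set xs"
proof (induction ps xs rule: fill.induct)
  case (3 ps xs)
  then show ?case by (cases xs) auto
qed auto

lemma fill_in_nlists:
  assumes "set ps \<subseteq> insert None (Some ` B)" "count_list ps None \<le> length xs" "set xs \<subseteq> B"
  shows "fill ps xs \<in> nlists (length ps) B"
  using set_fill_subset[OF assms(2)] assms(1,3) by (fastforce simp: nlists_def)

lemma patterns_fill_in_nlists:
  assumes "ps \<in> patterns n t B" "u + t \<le> d" "xs \<in> nlists d B"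
  shows "fill ps (drop u xs) \<in> nlists n B"
proof -
  have ps: "length ps = n" "set ps \<subseteq> insert None (Some ` B)" "count_list ps None = t"
    using assms(1) by (simp_all add: patterns_iff)
  moreover have "set (drop u xs) \<subseteq> B" "t \<le> length (drop u xs)"
    using assms set_drop_subset[of u xs] by (auto simp: nlists_def)
  ultimately show ?thesis using fill_in_nlists[of ps B "drop u xs"] by simp
qed

lemma map_fill:
  "count_list ps None \<le> length xs \<Longrightarrow>
    map h (fill ps xs) = fill (map (map_option h) ps) (map h xs)"
proof (induction ps xs rule: fill.induct)
  case (3 ps xs)
  then show ?case by (cases xs) auto
qed auto

text \<open>This is how operands, some of which are known constants, are recognized as the arguments
  of a translation: the constants go into the pattern, the other operands become its
  variables.\<close>

lemma fill_filter:
  "fill (map (\<lambda>k. if P k then Some (c k) else None) ks) (map h (filter (\<lambda>k. \<not> P k) ks)) =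
    map (\<lambda>k. if P k then c k else h k) ks"
  by (induction ks) auto

lemma count_list_filter:
  "count_list (map (\<lambda>k. if P k then Some (c k) else None) ks) None =
    length (filter (\<lambda>k. \<not> P k) ks)"
  by (induction ks) auto

lemma nth_fill_None:
  assumes "p < length ps" "ps ! p = None"
  shows "fill ps xs ! p = hd (drop (count_list (take p ps) None) xs)"
    and "count_list (take p ps) None < count_list ps None"
proof -
  obtain as bs where ps: "ps = as @ None # bs" "p = length as"
    using assms id_take_nth_drop[of p ps] by (metis length_take min.absorb4)
  show "fill ps xs ! p = hd (drop (count_list (take p ps) None) xs)"
    by (simp add: ps fill_append nth_append)
  show "count_list (take p ps) None < count_list ps None"
    by (simp add: ps)
qed

lemma nth_fill_Some:
  assumes "p < length ps" "ps ! p = Some c"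
  shows "fill ps xs ! p = c"
proof -
  obtain as bs where ps: "ps = as @ Some c # bs" "p = length as"
    using assms id_take_nth_drop[of p ps] by (metis length_take min.absorb4)
  show ?thesis by (simp add: ps fill_append nth_append)
qed

text \<open>\<open>qs\<close> arises from \<open>ps\<close> by turning its \<open>q\<close>-th
  \<open>None\<close>, counted from 0, into \<open>Some c\<close>. In this way the members of
  \<open>ebtrl\<close> of a function given by a pattern are again given by patterns, with one
  variable fewer.\<close>

lemma fill_insert_constant:
  assumes "ps \<in> patterns m (Suc d) B" "q \<le> d" "c \<in> B"
  shows "\<exists>qs\<in>patterns m d B. \<forall>xs. length xs = d \<longrightarrow> fill ps (take q xs @ c # drop q xs) = fill qs xs"
  using assms
proof (induction ps arbitrary: m d q)
  case Nil
  then show ?case by (simp add: patterns_iff)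
next
  case (Cons p ps)
  obtain m' where m: "m = Suc m'" using Cons.prems(1) by (auto simp: patterns_iff)
  show ?case
  proof (cases p)
    case (Some e)
    then have "ps \<in> patterns m' (Suc d) B" "e \<in> B" using Cons.prems(1) m by (auto simp: patterns_iff)
    from Cons.IH[OF this(1) Cons.prems(2,3)] obtain qs where
      "qs \<in> patterns m' d B" "\<forall>xs. length xs = d \<longrightarrow> fill ps (take q xs @ c # drop q xs) = fill qs xs"
      by blast
    then show ?thesis using Some m \<open>e \<in> B\<close>
      by (intro bexI[of _ "Some e # qs"]) (auto simp: patterns_iff)
  next
    case None
    then have ps: "ps \<in> patterns m' d B" using Cons.prems(1) m by (auto simp: patterns_iff)
    show ?thesis
    proof (cases q)
      case 0
      then show ?thesis using None m ps Cons.prems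
        by (intro bexI[of _ "Some c # ps"]) (auto simp: patterns_iff)
    next
      case (Suc q')
      then obtain d' where d: "d = Suc d'" using Cons.prems(2) by (cases d) auto
      from Cons.IH[of m' d' q'] ps d Suc Cons.prems(2,3) obtain qs where qs:
        "qs \<in> patterns m' d' B"
        "\<forall>xs. length xs = d' \<longrightarrow> fill ps (take q' xs @ c # drop q' xs) = fill qs xs"
        by auto
      have "fill (p # ps) (take q xs @ c # drop q xs) = fill (None # qs) xs" if "length xs = d" for xs
        using that qs(2) d Suc None by (cases xs) auto
      then show ?thesis using qs(1) m d
        by (intro bexI[of _ "None # qs"]) (auto simp: patterns_iff)
    qed
  qed
qed

section \<open>Internal reflexivity and transitivity in simple arity\<close>

text \<open>
  Both functions arise from \<open>g\<close> by \<^const>\<open>eftrl\<close> followed by \<^const>\<open>ebtrl\<close>.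
\<close>
lemma simple_internally_reflexive_insert:
  assumes refl: "simple_internally_reflexive C B d \<rho>"
    and g: "g \<in> \<rho>" and c: "c \<in> B" and p: "p < d"
  shows "(\<lambda>xs\<in>nlists d B. g (take p (tl xs) @ c # drop p (tl xs))) \<in> \<rho>" (is "?L \<in> \<rho>")
    and "(\<lambda>xs\<in>nlists d B. g (take p (butlast xs) @ c # drop p (butlast xs))) \<in> \<rho>" (is "?R \<in> \<rho>")
proof -
  let ?h = "\<lambda>xs\<in>nlists (Suc d) B. g (tl xs)" and ?k = "\<lambda>xs\<in>nlists (Suc d) B. g (butlast xs)"
  have "?h \<in> eftrl B d g" "?k \<in> eftrl B d g" by (auto simp: eftrl_def)
  then have sub: "ebtrl B (Suc d) ?h \<subseteq> \<rho>" "ebtrl B (Suc d) ?k \<subseteq> \<rho>"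
    using refl g unfolding simple_internally_reflexive_def ostar_def by blast+
  have ins: "take i xs @ c # drop i xs \<in> nlists (Suc d) B" if "xs \<in> nlists d B" for xs i
  proof -
    have "set (take i xs) \<subseteq> B" "set (drop i xs) \<subseteq> B"
      using that set_take_subset[of i xs] set_drop_subset[of i xs] unfolding nlists_def by auto
    then show ?thesis using that c by (auto simp: nlists_def)
  qed
  have "(\<lambda>xs\<in>nlists d B. ?h (take (Suc p) xs @ c # drop (Suc p) xs)) \<in> ebtrl B (Suc d) ?h"
    unfolding ebtrl_def using p c by auto
  moreover have "(\<lambda>xs\<in>nlists d B. ?h (take (Suc p) xs @ c # drop (Suc p) xs)) = ?L"
  proof (rule restrict_ext)
    fix xs assume xs: "xs \<in> nlists d B"
    then have "xs \<noteq> []" using p by (auto simp: nlists_def)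
    then show "?h (take (Suc p) xs @ c # drop (Suc p) xs) = g (take p (tl xs) @ c # drop p (tl xs))"
      using ins[OF xs, of "Suc p"] by (cases xs) auto
  qed
  ultimately show "?L \<in> \<rho>" using sub by auto
  have "(\<lambda>xs\<in>nlists d B. ?k (take p xs @ c # drop p xs)) \<in> ebtrl B (Suc d) ?k"
    unfolding ebtrl_def using p c by fastforce
  moreover have "(\<lambda>xs\<in>nlists d B. ?k (take p xs @ c # drop p xs)) = ?R"
  proof (rule restrict_ext)
    fix xs assume xs: "xs \<in> nlists d B"
    then have "length xs = d" by (auto simp: nlists_def)
    then show "?k (take p xs @ c # drop p xs) = g (take p (butlast xs) @ c # drop p (butlast xs))"
      using ins[OF xs, of p] p by (simp add: butlast_append take_butlast drop_butlast)
  qed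
  ultimately show "?R \<in> \<rho>" using sub by auto
qed

text \<open>
  Induction on the number of constants: insert one of the constants of \<open>ps\<close> into \<open>g\<close>, and let the new
  fictitious variable at the end take its place among the remaining positions.
\<close>
lemma simple_internally_reflexive_fill:
  assumes refl: "simple_internally_reflexive C B d \<rho>"
    and sub: "\<rho> \<subseteq> nlists d B \<rightarrow>\<^sub>E C"
    and "g \<in> \<rho>" "ps \<in> patterns d t B" "u + t \<le> d"
  shows "(\<lambda>xs\<in>nlists d B. g (fill ps (drop u xs))) \<in> \<rho>"
  using assms(3-5)
proof (induction "d - t" arbitrary: g ps t u)
  case 0
  then have "d = t" "u = 0" by simp_all
  then have "ps = replicate d None" using 0 patterns_full by blast
  then have "(\<lambda>xs\<in>nlists d B. g (fill ps (drop u xs))) = (\<lambda>xs\<in>nlists d B. g xs)"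
    using \<open>u = 0\<close> by (intro restrict_ext) (auto simp: fill_replicate_None nlists_def)
  also have "\<dots> = g" using 0 sub by (auto simp: PiE_def extensional_restrict)
  finally show ?case using 0 by simp
next
  case (Suc k)
  have ps: "length ps = d" "set ps \<subseteq> insert None (Some ` B)" "count_list ps None = t"
    using Suc.prems(2) by (auto simp: patterns_iff)
  have "\<exists>e\<in>set ps. e \<noteq> None"
  proof (rule ccontr)
    assume "\<not> ?thesis"
    then have "ps = replicate d None" using ps(1) by (auto intro: replicate_eqI)
    then show False using Suc.hyps(2) ps(3) by simp
  qed
  then obtain as c bs where split: "ps = as @ Some c # bs"
    by (metis not_None_eq split_list)
  define p where "p = length as"
  have c: "c \<in> B" and p: "p < d" using ps split by (auto simp: p_def)
  have ins: "take p (fill (as @ bs) w) @ c # drop p (fill (as @ bs) w) = fill ps w" for w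
    by (simp add: split fill_append p_def)
  have arity: "fill qs (drop v xs) \<in> nlists d B"
    if "qs \<in> patterns d (Suc t) B" "v + Suc t \<le> d" "xs \<in> nlists d B" for qs v xs
    using patterns_fill_in_nlists that by blast
  show ?case
  \<comment> \<open>The new position needs a variable from outside the block \<open>u\<close>, ...,
    \<open>u + t - 1\<close>. If nothing precedes the block, \<open>t < d\<close> leaves a variable
    behind it; otherwise the variable just before it is taken.\<close>
  proof (cases u)
    case 0
    let ?g = "\<lambda>xs\<in>nlists d B. g (take p (butlast xs) @ c # drop p (butlast xs))"
    have g: "?g \<in> \<rho>" using simple_internally_reflexive_insert(2)[OF refl Suc.prems(1) c p] .
    have qs: "(as @ bs) @ [None] \<in> patterns d (Suc t) B"
      using ps split by (auto simp: patterns_iff)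
    have "(\<lambda>xs\<in>nlists d B. ?g (fill ((as @ bs) @ [None]) (drop 0 xs))) \<in> \<rho>"
      using Suc.hyps(2) by (intro Suc.hyps(1)[OF _ g qs]) auto
    also have "(\<lambda>xs\<in>nlists d B. ?g (fill ((as @ bs) @ [None]) (drop 0 xs))) =
        (\<lambda>xs\<in>nlists d B. g (fill ps (drop u xs)))"
    proof (rule restrict_ext)
      fix xs assume "xs \<in> nlists d B"
      then have "fill ((as @ bs) @ [None]) (drop 0 xs) \<in> nlists d B"
        using Suc.hyps(2) by (intro arity[OF qs]) auto
      moreover have "butlast (fill ((as @ bs) @ [None]) xs) = fill (as @ bs) xs"
        unfolding fill_append[of "as @ bs"] by simp
      ultimately show "?g (fill ((as @ bs) @ [None]) (drop 0 xs)) = g (fill ps (drop u xs))"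
        by (simp add: ins 0 del: append_assoc)
    qed
    finally show ?thesis .
  next
    case (Suc v)
    let ?g = "\<lambda>xs\<in>nlists d B. g (take p (tl xs) @ c # drop p (tl xs))"
    have g: "?g \<in> \<rho>" using simple_internally_reflexive_insert(1)[OF refl Suc.prems(1) c p] .
    have qs: "None # as @ bs \<in> patterns d (Suc t) B"
      using ps split by (auto simp: patterns_iff)
    have v: "v + Suc t \<le> d" using Suc Suc.prems(3) by simp
    have "(\<lambda>xs\<in>nlists d B. ?g (fill (None # as @ bs) (drop v xs))) \<in> \<rho>"
      using Suc.hyps(2) v by (intro Suc.hyps(1)[OF _ g qs]) auto
    also have "(\<lambda>xs\<in>nlists d B. ?g (fill (None # as @ bs) (drop v xs))) =
        (\<lambda>xs\<in>nlists d B. g (fill ps (drop u xs)))"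
    proof (rule restrict_ext)
      fix xs assume "xs \<in> nlists d B"
      then have "fill (None # as @ bs) (drop v xs) \<in> nlists d B"
        by (rule arity[OF qs v])
      moreover have "tl (drop v xs) = drop u xs" by (simp add: Suc drop_Suc drop_tl)
      ultimately show "?g (fill (None # as @ bs) (drop v xs)) = g (fill ps (drop u xs))"
        by (simp add: ins)
    qed
    finally show ?thesis .
  qed
qed

text \<open>
  Prefixes of length \<open>m\<close> with only \<open>d\<close> variables are treated for decreasing \<open>m\<close>. Position \<open>m\<close> repeats
  an earlier one. If that one holds a constant, then append the same constant; otherwise append a new
  variable and identify it with the earlier one by \<^const>\<open>Deltas\<close>.
\<close>
lemma simple_transitive_periodic:
  fixes H :: "'b list \<Rightarrow> 'c"
  assumes trans: "simple_transitive C B d \<rho>"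
    and sub: "\<rho> \<subseteq> nlists d B \<rightarrow>\<^sub>E C"
    and N: "d \<le> N" "d = 0 \<Longrightarrow> N = 0"
    and H: "\<And>ps. ps \<in> patterns N d B \<Longrightarrow> (\<lambda>xs\<in>nlists d B. H (fill ps xs)) \<in> \<rho>"
  shows "(\<lambda>xs\<in>nlists d B. H (map (\<lambda>i. xs ! (i mod d)) [0..<N])) \<in> \<rho>"
proof -
  \<comment> \<open>The missing entries repeat the first \<open>d\<close> ones with period
    \<open>d\<close>, so a full word is unchanged and the word of the \<open>d\<close> variables
    becomes the periodic word of the claim.\<close>
  define ext where "ext ys = ys @ map (\<lambda>i. ys ! (i mod d)) [length ys..<N]" for ys :: "'b list"
  have ext_snoc: "ext (ys @ [ys ! (length ys mod d)]) = ext ys"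
    if "d \<le> length ys" "length ys < N" for ys
  proof -
    have "d > 0" using N(2) that by (cases d) auto
    then have "i mod d < length ys" for i 
      using that(1) mod_less_divisor[of d i] by linarith
    then show ?thesis using that(2) by (auto simp: ext_def upt_conv_Cons nth_append)
  qed
  have "(\<lambda>xs\<in>nlists d B. H (ext (fill ps xs))) \<in> \<rho>"
    if "m \<le> N" "d \<le> m" "ps \<in> patterns m d B" for m ps
    using that
  proof (induction m arbitrary: ps rule: inc_induct)
    case base
    then have "ext (fill ps xs) = fill ps xs" for xs by (auto simp: ext_def patterns_iff)
    then show ?case using H[OF base(2)] by (simp only:)
  next
    case (step m)
    have ps: "length ps = m" "set ps \<subseteq> insert None (Some ` B)" "count_list ps None = d"
      using step.prems(2) by (auto simp: patterns_iff)
    \<comment> \<open>For \<open>d = 0\<close> there would be no earlier position to repeat;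
      \<open>m < N\<close> excludes this case.\<close>
    have "d > 0" using N(2) step.hyps by (cases d) auto
    define p where "p = m mod d"
    have "p < d" using \<open>d > 0\<close> by (simp add: p_def)
    then have p: "p < m" using step.prems(1) by simp
    have snoc: "ext (fill ps xs @ [fill ps xs ! p]) = ext (fill ps xs)" for xs
      using ext_snoc[of "fill ps xs"] step.hyps step.prems(1) ps(1) by (simp add: p_def)
    show ?case
    proof (cases "ps ! p")
      case (Some c)
      then have "Some c \<in> set ps" using p ps(1) nth_mem by metis
      then have "ps @ [Some c] \<in> patterns (Suc m) d B" using ps by (auto simp: patterns_iff)
      then have "(\<lambda>xs\<in>nlists d B. H (ext (fill (ps @ [Some c]) xs))) \<in> \<rho>"
        using step.IH step.prems(1) le_SucI by blast
      moreover have "ext (fill (ps @ [Some c]) xs) = ext (fill ps xs)" for xs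
        using snoc[of xs] nth_fill_Some[of p ps c xs] Some p ps(1) by (simp add: fill_append)
      ultimately show ?thesis by (simp only:)
    next
      case None
      define i where "i = count_list (take p ps) None"
      have i: "i < d" using nth_fill_None(2)[of p ps] None p ps by (simp add: i_def)
      define h where "h = (\<lambda>ys\<in>nlists (Suc d) B. H (ext (fill (ps @ [None]) ys)))"
      have pat: "ps @ [None] \<in> patterns (Suc m) (Suc d) B" using ps by (auto simp: patterns_iff)
      \<comment> \<open>Fixing any one of the \<open>d + 1\<close> variables of \<open>h\<close>
        yields a pattern of length \<open>m + 1\<close> with \<open>d\<close> variables, which the
        induction hypothesis covers.\<close>
      have ebtrl: "ebtrl B (Suc d) h \<subseteq> \<rho>"
      proof
        fix k assume "k \<in> ebtrl B (Suc d) h"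
        then obtain q c where k: "k = (\<lambda>xs\<in>nlists d B. h (take q xs @ c # drop q xs))"
          and q: "q \<le> d" and c: "c \<in> B"
          by (auto simp: ebtrl_def)
        obtain qs where qs: "qs \<in> patterns (Suc m) d B"
          "\<And>xs. length xs = d \<Longrightarrow> fill (ps @ [None]) (take q xs @ c # drop q xs) = fill qs xs"
          using fill_insert_constant[OF pat q c] by blast
        have "k = (\<lambda>xs\<in>nlists d B. H (ext (fill qs xs)))"
          unfolding k
        proof (rule restrict_ext)
          fix xs assume xs: "xs \<in> nlists d B"
          then have "take q xs @ c # drop q xs \<in> nlists (Suc d) B"
            using c set_take_subset[of q xs] set_drop_subset[of q xs]
            by (auto simp: nlists_def)
          then show "h (take q xs @ c # drop q xs) = H (ext (fill qs xs))"
            using qs(2)[of xs] xs by (simp add: h_def nlists_def)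
        qed
        then show "k \<in> \<rho>" using step.IH[OF _ qs(1)] step.prems(1) le_SucI by blast
      qed
      \<comment> \<open>The values of \<open>h\<close> lie in \<open>C\<close> because fixing its
        first argument already gives a member of \<rho>.\<close>
      have "h \<in> nlists (Suc d) B \<rightarrow>\<^sub>E C"
      proof
        fix ys assume "ys \<in> nlists (Suc d) B"
        then obtain c xs where ys: "ys = c # xs" and c: "c \<in> B" and xs: "xs \<in> nlists d B"
          by (auto simp: nlists_def length_Suc_conv)
        have "(\<lambda>xs\<in>nlists d B. h (take 0 xs @ c # drop 0 xs)) \<in> \<rho>"
          using ebtrl c unfolding ebtrl_def by force
        then have "(\<lambda>xs\<in>nlists d B. h (take 0 xs @ c # drop 0 xs)) xs \<in> C" using sub xs by blast
        then show "h ys \<in> C" using xs ys by simp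
      qed (auto simp: h_def)
      then have "h \<in> ostar C B d \<rho>" using ebtrl by (simp add: ostar_def)
      \<comment> \<open>The new last variable, number \<open>d\<close>, is identified with variable
        \<open>i\<close>, the one at position \<open>p\<close> of \<open>ps\<close>;
        \<open>i < d\<close> makes this an instance of \<open>Deltas\<close> with
        \<open>j = d\<close>.\<close>
      moreover have "(\<lambda>xs\<in>nlists d B. h (take d xs @ xs ! i # drop d xs)) \<in> Deltas B d h"
        using i unfolding Deltas_def by blast
      ultimately have "(\<lambda>xs\<in>nlists d B. h (take d xs @ xs ! i # drop d xs)) \<in> \<rho>"
        using trans unfolding simple_transitive_def by blast
      also have "(\<lambda>xs\<in>nlists d B. h (take d xs @ xs ! i # drop d xs)) =
          (\<lambda>xs\<in>nlists d B. H (ext (fill ps xs)))"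
      proof (rule restrict_ext)
        fix xs assume xs: "xs \<in> nlists d B"
        then have len: "length xs = d" and "xs @ [xs ! i] \<in> nlists (Suc d) B"
          using i by (auto simp: nlists_def)
        moreover have "fill (ps @ [None]) (xs @ [xs ! i]) = fill ps xs @ [fill ps xs ! p]"
          using nth_fill_None(1)[of p ps xs] None p ps len i
          by (simp add: fill_append fill_append_arg i_def[symmetric] hd_drop_conv_nth)
        ultimately show "h (take d xs @ xs ! i # drop d xs) = H (ext (fill ps xs))"
          by (simp add: h_def snoc)
      qed
      finally show ?thesis .
    qed
  qed
  \<comment> \<open>At \<open>m = d\<close> the pattern consists of the \<open>d\<close> variables
    alone, and no constant is left.\<close>
  from this[OF N(1) order_refl, of "replicate d None"]
  have "(\<lambda>xs\<in>nlists d B. H (ext (fill (replicate d None) xs))) \<in> \<rho>"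
    by simp
  also have "(\<lambda>xs\<in>nlists d B. H (ext (fill (replicate d None) xs))) =
      (\<lambda>xs\<in>nlists d B. H (map (\<lambda>i. xs ! (i mod d)) [0..<N]))"
  proof (rule restrict_ext)
    fix xs assume "xs \<in> nlists d B"
    then have "length xs = d" by (auto simp: nlists_def)
    moreover have "ext xs = map (\<lambda>i. xs ! (i mod d)) [0..<N]" if "length xs = d"
      using that N(1) by (intro nth_equalityI) (auto simp: ext_def nth_append)
    ultimately show "H (ext (fill (replicate d None) xs)) = H (map (\<lambda>i. xs ! (i mod d)) [0..<N])"
      by (simp add: fill_replicate_None)
  qed
  finally show ?thesis .
qed

section \<open>Points of a rectangular arity and currying\<close>

lemma rect_iff:
  "X \<in> rect \<alpha> \<longleftrightarrow>
    length X = length \<alpha> \<and> (\<forall>j<length \<alpha>. X ! j \<in> nlists (snd (\<alpha> ! j)) (fst (\<alpha> ! j)))"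
proof (induction \<alpha> arbitrary: X)
  case Nil
  then show ?case by (simp add: rect_def)
next
  case (Cons a \<alpha>)
  obtain B d where a: "a = (B, d)" by fastforce
  have "X \<in> rect (a # \<alpha>) \<longleftrightarrow> (\<exists>x Y. X = x # Y \<and> x \<in> nlists d B \<and> Y \<in> rect \<alpha>)"
    by (auto simp: rect_def set_Cons_def a)
  then show ?case unfolding Cons by (cases X) (auto simp: a All_less_Suc2)
qed

lemma rect_update:
  "X \<in> rect \<alpha> \<Longrightarrow> W \<in> nlists (snd (\<alpha> ! j)) (fst (\<alpha> ! j)) \<Longrightarrow> X[j := W] \<in> rect \<alpha>"
  by (cases "j < length X") (auto simp: rect_iff nth_list_update list_update_beyond)

text \<open>The bijection between \<alpha> and the product of its \<open>j\<close>-th factor with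
  the remaining factors, which underlies \<open>curry_at\<close>.\<close>

lemma rect_insert_iff:
  assumes j: "j < length \<alpha>" and Y: "length Y = length \<alpha> - 1"
  shows "take j Y @ W # drop j Y \<in> rect \<alpha> \<longleftrightarrow>
    W \<in> nlists (snd (\<alpha> ! j)) (fst (\<alpha> ! j)) \<and> Y \<in> rect (del_factor \<alpha> j)" (is "?L = ?R")
proof -
  have len: "length (take j Y @ W # drop j Y) = length \<alpha>"
    and len': "length (del_factor \<alpha> j) = length \<alpha> - 1"
    using j Y by (auto simp: del_factor_def)
  have nth: "(take j Y @ W # drop j Y) ! i = (if i < j then Y ! i else if i = j then W else Y ! (i - 1))"
    if "i < length \<alpha>" for i
    using that j Y by (auto simp: nth_append min_def nth_Cons' )
  have nth': "del_factor \<alpha> j ! i = (if i < j then \<alpha> ! i else \<alpha> ! Suc i)" if "i < length \<alpha> - 1" for i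
    using that j by (auto simp: del_factor_def nth_append min_def)
  show ?thesis
  proof
    assume L: ?L
    then have *: "(take j Y @ W # drop j Y) ! i \<in> nlists (snd (\<alpha> ! i)) (fst (\<alpha> ! i))"
      if "i < length \<alpha>" for i
      using that unfolding rect_iff by blast
    have "W \<in> nlists (snd (\<alpha> ! j)) (fst (\<alpha> ! j))" using *[OF j] nth[OF j] by simp
    moreover have "Y ! i \<in> nlists (snd (del_factor \<alpha> j ! i)) (fst (del_factor \<alpha> j ! i))"
      if "i < length \<alpha> - 1" for i
      using *[of i] *[of "Suc i"] nth[of i] nth[of "Suc i"] nth'[of i] that by (auto split: if_splits)
    ultimately show ?R unfolding rect_iff len' using Y by simp
  next
    assume R: ?R
    then have *: "Y ! i \<in> nlists (snd (del_factor \<alpha> j ! i)) (fst (del_factor \<alpha> j ! i))"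
      if "i < length \<alpha> - 1" for i
      using that unfolding rect_iff len' by blast
    have "(take j Y @ W # drop j Y) ! i \<in> nlists (snd (\<alpha> ! i)) (fst (\<alpha> ! i))"
      if i: "i < length \<alpha>" for i
    proof -
      consider "i < j" | "i = j" | "j < i" by linarith
      then show ?thesis
      proof cases
        case 1
        then show ?thesis using *[of i] nth[OF i] nth'[of i] j by simp
      next
        case 2
        then show ?thesis using R nth[OF i] by simp
      next
        case 3
        then obtain k where "i = Suc k" by (cases i) auto
        then show ?thesis using 3 *[of k] nth[OF i] nth'[of k] i by simp
      qed
    qed
    then show ?L unfolding rect_iff len by simp
  qed
qed

lemma rect_insert:
  assumes "j < length \<alpha>" "W \<in> nlists (snd (\<alpha> ! j)) (fst (\<alpha> ! j))" "Y \<in> rect (del_factor \<alpha> j)"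
  shows "take j Y @ W # drop j Y \<in> rect \<alpha>"
    and "(take j Y @ W # drop j Y) ! j = W"
    and "(take j Y @ W # drop j Y)[j := V] = take j Y @ V # drop j Y"
proof -
  have "length Y = length \<alpha> - 1" using assms by (auto simp: rect_iff del_factor_def)
  then show "take j Y @ W # drop j Y \<in> rect \<alpha>"
    and "(take j Y @ W # drop j Y) ! j = W"
    and "(take j Y @ W # drop j Y)[j := V] = take j Y @ V # drop j Y"
    using assms by (auto simp: rect_insert_iff nth_append list_update_append)
qed

lemma curry_at_cong:
  assumes "j < length \<alpha>" "\<And>X. X \<in> rect \<alpha> \<Longrightarrow> g X = h X"
  shows "curry_at \<alpha> j g = curry_at \<alpha> j h"
  unfolding curry_at_def using rect_insert(1)[OF assms(1)] assms(2)
  by (intro restrict_ext) auto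

text \<open>Currying is injective on functions restricted to \<open>rect \<alpha>\<close>. Closure
  properties of the curried relation can therefore be read as closure properties of \<rho> that
  change the single coordinate \<open>j\<close>.\<close>

lemma curry_at_in_image_iff:
  assumes sub: "\<rho> \<subseteq> rect \<alpha> \<rightarrow>\<^sub>E A" and j: "j < length \<alpha>"
  shows "curry_at \<alpha> j F \<in> curry_at \<alpha> j ` \<rho> \<longleftrightarrow> restrict F (rect \<alpha>) \<in> \<rho>"
proof
  assume "curry_at \<alpha> j F \<in> curry_at \<alpha> j ` \<rho>"
  then obtain g where g: "g \<in> \<rho>" "curry_at \<alpha> j F = curry_at \<alpha> j g" by blast
  have "F X = g X" if X: "X \<in> rect \<alpha>" for X
  proof -
    define Y where "Y = take j X @ drop (Suc j) X"
    have len: "length X = length \<alpha>" "length Y = length \<alpha> - 1"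
      using X j by (auto simp: rect_iff Y_def)
    have XY: "X = take j Y @ X ! j # drop j Y"
      using id_take_nth_drop[of j X] j len by (simp add: Y_def)
    then have *: "X ! j \<in> nlists (snd (\<alpha> ! j)) (fst (\<alpha> ! j))" "Y \<in> rect (del_factor \<alpha> j)"
      using X rect_insert_iff[OF j len(2), of "X ! j"] by auto
    have "curry_at \<alpha> j F (X ! j) Y = curry_at \<alpha> j g (X ! j) Y" using g by simp
    then show ?thesis using * XY by (simp add: curry_at_def)
  qed
  then have "restrict F (rect \<alpha>) = restrict g (rect \<alpha>)" by (intro restrict_ext)
  also have "\<dots> = g" using g sub by (auto simp: PiE_def extensional_restrict)
  finally show "restrict F (rect \<alpha>) \<in> \<rho>" using g by simp
next
  assume "restrict F (rect \<alpha>) \<in> \<rho>"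
  moreover have "curry_at \<alpha> j (restrict F (rect \<alpha>)) = curry_at \<alpha> j F"
    using j by (intro curry_at_cong) auto
  ultimately show "curry_at \<alpha> j F \<in> curry_at \<alpha> j ` \<rho>" by (metis image_eqI)
qed

lemma curry_at_image_subset:
  assumes "\<rho> \<subseteq> rect \<alpha> \<rightarrow>\<^sub>E A" "j < length \<alpha>"
  shows "curry_at \<alpha> j ` \<rho> \<subseteq>
    nlists (snd (\<alpha> ! j)) (fst (\<alpha> ! j)) \<rightarrow>\<^sub>E (rect (del_factor \<alpha> j) \<rightarrow>\<^sub>E A)"
  using assms rect_insert(1)[OF assms(2)] unfolding curry_at_def by fastforce

section \<open>From simple to compound arity: one factor, then all factors\<close>

lemma internally_reflexive_fill_at:
  assumes refl: "internally_reflexive A \<alpha> \<rho>" and sub: "\<rho> \<subseteq> rect \<alpha> \<rightarrow>\<^sub>E A"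
    and j: "j < length \<alpha>" and g: "g \<in> \<rho>"
    and ps: "ps \<in> patterns (snd (\<alpha> ! j)) t (fst (\<alpha> ! j))" "u + t \<le> snd (\<alpha> ! j)"
  shows "(\<lambda>X\<in>rect \<alpha>. g (X[j := fill ps (drop u (X ! j))])) \<in> \<rho>"
proof -
  let ?D = "nlists (snd (\<alpha> ! j)) (fst (\<alpha> ! j))"
  have "(\<lambda>xs\<in>?D. curry_at \<alpha> j g (fill ps (drop u xs))) \<in> curry_at \<alpha> j ` \<rho>"
    using refl j g ps
    by (intro simple_internally_reflexive_fill[OF _ curry_at_image_subset[OF sub j]])
      (auto simp: internally_reflexive_def)
  also have "(\<lambda>xs\<in>?D. curry_at \<alpha> j g (fill ps (drop u xs))) =
      curry_at \<alpha> j (\<lambda>X. g (X[j := fill ps (drop u (X ! j))]))"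
    unfolding curry_at_def
    using patterns_fill_in_nlists[OF ps] rect_insert(2,3)[OF j]
    by (intro restrict_ext) (auto intro!: restrict_ext)
  finally show ?thesis unfolding curry_at_in_image_iff[OF sub j] .
qed

lemma transitive_periodic_at:
  fixes H :: "'b list list \<Rightarrow> 'a"
  assumes trans: "transitive A \<alpha> \<rho>" and sub: "\<rho> \<subseteq> rect \<alpha> \<rightarrow>\<^sub>E A"
    and j: "j < length \<alpha>"
    and N: "snd (\<alpha> ! j) \<le> N" "snd (\<alpha> ! j) = 0 \<Longrightarrow> N = 0"
    and H: "\<And>ps. ps \<in> patterns N (snd (\<alpha> ! j)) (fst (\<alpha> ! j)) \<Longrightarrow>
      (\<lambda>X\<in>rect \<alpha>. H (X[j := fill ps (X ! j)])) \<in> \<rho>"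
  shows "(\<lambda>X\<in>rect \<alpha>. H (X[j := map (\<lambda>i. X ! j ! (i mod snd (\<alpha> ! j))) [0..<N]])) \<in> \<rho>"
proof -
  let ?D = "nlists (snd (\<alpha> ! j)) (fst (\<alpha> ! j))"
  \<comment> \<open>\<open>W\<close> is also a word of length \<open>N\<close> here, outside the
    domain of \<open>curry_at \<alpha> j H\<close>, so the currying is written out.\<close>
  define H' where "H' W = (\<lambda>Y\<in>rect (del_factor \<alpha> j). H (take j Y @ W # drop j Y))" for W
  have curry: "(\<lambda>xs\<in>?D. H' (k xs)) = curry_at \<alpha> j (\<lambda>X. H (X[j := k (X ! j)]))" for k
    unfolding curry_at_def H'_def
    using rect_insert(2,3)[OF j] by (intro restrict_ext) (auto intro!: restrict_ext)
  have "(\<lambda>xs\<in>?D. H' (map (\<lambda>i. xs ! (i mod snd (\<alpha> ! j))) [0..<N])) \<in> curry_at \<alpha> j ` \<rho>"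
  proof (rule simple_transitive_periodic[OF _ curry_at_image_subset[OF sub j] N])
    show "simple_transitive (rect (del_factor \<alpha> j) \<rightarrow>\<^sub>E A) (fst (\<alpha> ! j)) (snd (\<alpha> ! j))
        (curry_at \<alpha> j ` \<rho>)"
      using trans j by (auto simp: transitive_def)
    show "(\<lambda>xs\<in>?D. H' (fill ps xs)) \<in> curry_at \<alpha> j ` \<rho>"
      if "ps \<in> patterns N (snd (\<alpha> ! j)) (fst (\<alpha> ! j))" for ps
      unfolding curry curry_at_in_image_iff[OF sub j] using H[OF that] .
  qed
  then show ?thesis unfolding curry curry_at_in_image_iff[OF sub j] .
qed

text \<open>The coordinates are changed independently of each other, so the factors can be treated
  one at a time; the induction is on the number \<open>m\<close> of factors already treated.\<close>

lemma internally_reflexive_fill: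
  assumes refl: "internally_reflexive A \<alpha> \<rho>" and sub: "\<rho> \<subseteq> rect \<alpha> \<rightarrow>\<^sub>E A" and g: "g \<in> \<rho>"
    and ps: "\<And>j. j < length \<alpha> \<Longrightarrow> ps j \<in> patterns (snd (\<alpha> ! j)) (t j) (fst (\<alpha> ! j))"
      "\<And>j. j < length \<alpha> \<Longrightarrow> u j + t j \<le> snd (\<alpha> ! j)"
  shows "(\<lambda>X\<in>rect \<alpha>. g (map (\<lambda>j. fill (ps j) (drop (u j) (X ! j))) [0..<length \<alpha>])) \<in> \<rho>"
proof -
  have "(\<lambda>X\<in>rect \<alpha>. g (map (\<lambda>j. if j < m then fill (ps j) (drop (u j) (X ! j)) else X ! j)
      [0..<length \<alpha>])) \<in> \<rho>" if "m \<le> length \<alpha>" for m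
    using that
  proof (induction m)
    case 0
    have "(\<lambda>X\<in>rect \<alpha>. g (map ((!) X) [0..<length \<alpha>])) = restrict g (rect \<alpha>)"
      by (intro restrict_ext) (metis map_nth rect_iff)
    also have "\<dots> = g" using g sub by (auto simp: PiE_def extensional_restrict)
    finally show ?case using g by simp
  next
    case (Suc m)
    let ?g = "\<lambda>X\<in>rect \<alpha>. g (map (\<lambda>j. if j < m then fill (ps j) (drop (u j) (X ! j)) else X ! j)
      [0..<length \<alpha>])"
    have m: "m < length \<alpha>" using Suc by simp
    have "(\<lambda>X\<in>rect \<alpha>. ?g (X[m := fill (ps m) (drop (u m) (X ! m))])) \<in> \<rho>"
      using Suc m ps by (intro internally_reflexive_fill_at[OF refl sub]) auto
    also have "(\<lambda>X\<in>rect \<alpha>. ?g (X[m := fill (ps m) (drop (u m) (X ! m))])) =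
      (\<lambda>X\<in>rect \<alpha>. g (map (\<lambda>j. if j < Suc m then fill (ps j) (drop (u j) (X ! j)) else X ! j)
        [0..<length \<alpha>]))"
    proof (rule restrict_ext)
      fix X assume X: "X \<in> rect \<alpha>"
      then have "X[m := fill (ps m) (drop (u m) (X ! m))] \<in> rect \<alpha>"
        using ps[OF m] m by (intro rect_update patterns_fill_in_nlists) (auto simp: rect_iff)
      then show "?g (X[m := fill (ps m) (drop (u m) (X ! m))]) =
        g (map (\<lambda>j. if j < Suc m then fill (ps j) (drop (u j) (X ! j)) else X ! j) [0..<length \<alpha>])"
        using m X by (auto simp: rect_iff nth_list_update less_Suc_eq intro!: arg_cong[of _ _ g])
    qed
    finally show ?case .
  qed
  note this[OF order_refl]
  moreover have "map (\<lambda>j. if j < length \<alpha> then fill (ps j) (drop (u j) (X ! j)) else X ! j)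
      [0..<length \<alpha>] = map (\<lambda>j. fill (ps j) (drop (u j) (X ! j))) [0..<length \<alpha>]" for X
    by (rule map_cong) auto
  ultimately show ?thesis by (simp only:)
qed

text \<open>Again one factor at a time: factors below \<open>m\<close> carry periodic words, the
  others still carry patterns. The family \<open>ps\<close> stays arbitrary in the induction because
  the step for factor \<open>m\<close> needs the claim for \<open>ps(m := qs)\<close> with every
  \<open>qs\<close>.\<close>

lemma transitive_periodic:
  fixes H :: "'b list list \<Rightarrow> 'a"
  assumes trans: "transitive A \<alpha> \<rho>" and sub: "\<rho> \<subseteq> rect \<alpha> \<rightarrow>\<^sub>E A"
    and nonempty: "\<And>j. j < length \<alpha> \<Longrightarrow> fst (\<alpha> ! j) \<noteq> {}"
    and N: "\<And>j. j < length \<alpha> \<Longrightarrow> snd (\<alpha> ! j) \<le> N j"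
      "\<And>j. j < length \<alpha> \<Longrightarrow> snd (\<alpha> ! j) = 0 \<Longrightarrow> N j = 0"
    and H: "\<And>ps. (\<And>j. j < length \<alpha> \<Longrightarrow> ps j \<in> patterns (N j) (snd (\<alpha> ! j)) (fst (\<alpha> ! j))) \<Longrightarrow>
      (\<lambda>X\<in>rect \<alpha>. H (map (\<lambda>j. fill (ps j) (X ! j)) [0..<length \<alpha>])) \<in> \<rho>"
  shows "(\<lambda>X\<in>rect \<alpha>. H (map (\<lambda>j. map (\<lambda>i. X ! j ! (i mod snd (\<alpha> ! j))) [0..<N j])
    [0..<length \<alpha>])) \<in> \<rho>"
proof -
  define per where "per j xs = map (\<lambda>i. xs ! (i mod snd (\<alpha> ! j))) [0..<N j]" for j and xs :: "'b list"
  have "(\<lambda>X\<in>rect \<alpha>. H (map (\<lambda>j. if j < m then per j (X ! j) else fill (ps j) (X ! j))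
      [0..<length \<alpha>])) \<in> \<rho>"
    if "m \<le> length \<alpha>" "\<And>j. j < length \<alpha> \<Longrightarrow> ps j \<in> patterns (N j) (snd (\<alpha> ! j)) (fst (\<alpha> ! j))"
    for m ps
    using that
  proof (induction m arbitrary: ps)
    case 0
    then show ?case using H[of ps] by (simp only: not_less_zero if_False)
  next
    case (Suc m)
    have m: "m < length \<alpha>" using Suc.prems by simp
    define H' where "H' V = H (map (\<lambda>j. if j < m then per j (V ! j) else
      if j = m then V ! m else fill (ps j) (V ! j)) [0..<length \<alpha>])" for V
    have "(\<lambda>X\<in>rect \<alpha>. H' (X[m := map (\<lambda>i. X ! m ! (i mod snd (\<alpha> ! m))) [0..<N m]])) \<in> \<rho>"
    proof (rule transitive_periodic_at[OF trans sub m N[OF m]])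
      fix qs assume qs: "qs \<in> patterns (N m) (snd (\<alpha> ! m)) (fst (\<alpha> ! m))"
      have "(\<lambda>X\<in>rect \<alpha>. H (map (\<lambda>j. if j < m then per j (X ! j) else fill ((ps(m := qs)) j) (X ! j))
          [0..<length \<alpha>])) \<in> \<rho>"
        using Suc.prems qs m by (intro Suc.IH) auto
      also have "(\<lambda>X\<in>rect \<alpha>. H (map (\<lambda>j. if j < m then per j (X ! j) else fill ((ps(m := qs)) j) (X ! j))
          [0..<length \<alpha>])) = (\<lambda>X\<in>rect \<alpha>. H' (X[m := fill qs (X ! m)]))"
        using m unfolding H'_def
        by (intro restrict_ext) (auto simp: rect_iff nth_list_update intro!: arg_cong[of _ _ H])
      finally show "(\<lambda>X\<in>rect \<alpha>. H' (X[m := fill qs (X ! m)])) \<in> \<rho>" .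
    qed
    also have "(\<lambda>X\<in>rect \<alpha>. H' (X[m := map (\<lambda>i. X ! m ! (i mod snd (\<alpha> ! m))) [0..<N m]])) =
        (\<lambda>X\<in>rect \<alpha>. H (map (\<lambda>j. if j < Suc m then per j (X ! j) else fill (ps j) (X ! j))
          [0..<length \<alpha>]))"
      using m unfolding H'_def
      by (intro restrict_ext)
        (auto simp: rect_iff nth_list_update per_def less_Suc_eq intro!: arg_cong[of _ _ H])
    finally show ?case .
  qed
  note * = this[OF order_refl]
  \<comment> \<open>Instantiating \<open>*\<close> requires some family of patterns. Padding the
    \<open>d_j\<close> variables with a fixed constant gives one, as the base sets are
    nonempty.\<close>
  define ps where "ps j = replicate (snd (\<alpha> ! j)) None @
    replicate (N j - snd (\<alpha> ! j)) (Some (SOME c. c \<in> fst (\<alpha> ! j)))" for j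
  have "ps j \<in> patterns (N j) (snd (\<alpha> ! j)) (fst (\<alpha> ! j))" if "j < length \<alpha>" for j
    using N(1)[OF that] some_in_eq[of "fst (\<alpha> ! j)"] nonempty[OF that]
    by (auto simp: ps_def patterns_iff count_list_0_iff)
  then have "(\<lambda>X\<in>rect \<alpha>. H (map (\<lambda>j. if j < length \<alpha> then per j (X ! j) else fill (ps j) (X ! j))
      [0..<length \<alpha>])) \<in> \<rho>"
    by (rule *)
  moreover have "map (\<lambda>j. if j < length \<alpha> then per j (X ! j) else fill (ps j) (X ! j)) [0..<length \<alpha>] =
      map (\<lambda>j. per j (X ! j)) [0..<length \<alpha>]" for X
    by (rule map_cong) auto
  ultimately show ?thesis by (simp only: per_def)
qed

section \<open>Preservation by an operation and by its translations\<close>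

text \<open>A value \<open>g Z\<close> becomes a constant function when the pattern without
  variables that spells out \<open>Z\<close> is put into \<open>g\<close>.\<close>

lemma constant_in_relation:
  assumes "internally_reflexive A \<alpha> \<rho>" "\<rho> \<subseteq> rect \<alpha> \<rightarrow>\<^sub>E A" "c \<in> Im_rel \<alpha> \<rho>"
  shows "(\<lambda>X\<in>rect \<alpha>. c) \<in> \<rho>"
proof -
  obtain g Z where g: "g \<in> \<rho>" and Z: "Z \<in> rect \<alpha>" and c: "c = g Z"
    using assms(3) by (auto simp: Im_rel_def)
  have "map Some (Z ! j) \<in> patterns (snd (\<alpha> ! j)) 0 (fst (\<alpha> ! j))" if "j < length \<alpha>" for j
    using Z that by (auto simp: rect_iff patterns_iff nlists_def count_list_0_iff)
  then have "(\<lambda>X\<in>rect \<alpha>. g (map (\<lambda>j. fill (map Some (Z ! j)) (drop 0 (X ! j))) [0..<length \<alpha>])) \<in> \<rho>"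
    by (intro internally_reflexive_fill[OF assms(1,2) g]) auto
  moreover have "map (\<lambda>j. Z ! j) [0..<length \<alpha>] = Z"
    using Z map_nth[of Z] by (simp add: rect_iff)
  ultimately show ?thesis by (simp only: fill_map_Some c)
qed

lemma count_list_map_option [simp]:
  "count_list (map (map_option h) ps) None = count_list ps None"
  by (induction ps) auto

text \<open>The constants in the pattern of \<open>f'\<close> become constant functions, which are
  operands from \<rho> like the others; \<open>hs\<close> is the resulting list of all
  \<open>n\<close> operands of \<open>f\<close>.\<close>

lemma preserves_trl:
  assumes f: "preserves n f \<alpha> \<rho>" and sub: "\<rho> \<subseteq> rect \<alpha> \<rightarrow>\<^sub>E A"
    and const: "\<And>c. c \<in> K \<Longrightarrow> (\<lambda>X\<in>rect \<alpha>. c) \<in> \<rho>"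
    and f': "f' \<in> trl A K d n f"
  shows "preserves d f' \<alpha> \<rho>"
proof -
  obtain ps u t v where ps: "ps \<in> nlists n (insert None (Some ` K))"
    and t: "t = count_list ps None" "u + t + v = d"
    and f'_def: "f' = (\<lambda>xs\<in>nlists d A. f (fill ps (take t (drop u xs))))"
    using f' by (auto simp: trl_def)
  show ?thesis
    unfolding preserves_def
  proof
    fix gs assume gs: "gs \<in> nlists d \<rho>"
    define hs where "hs = fill (map (map_option (\<lambda>c. \<lambda>X\<in>rect \<alpha>. c)) ps) (take t (drop u gs))"
    have len: "length (take t (drop u gs)) = t" using gs t by (auto simp: nlists_def)
    have "set (take t (drop u gs)) \<subseteq> set gs" by (meson order_trans set_drop_subset set_take_subset)
    then have "set (take t (drop u gs)) \<subseteq> \<rho>" using gs by (auto simp: nlists_def)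
    then have "hs \<in> nlists (length (map (map_option (\<lambda>c. \<lambda>X\<in>rect \<alpha>. c)) ps)) \<rho>"
      unfolding hs_def using ps const len t(1)
      by (intro fill_in_nlists) (auto simp: nlists_def)
    then have "hs \<in> nlists n \<rho>" using ps by (simp add: nlists_def)
    then have "(\<lambda>X\<in>rect \<alpha>. f (map (\<lambda>g. g X) hs)) \<in> \<rho>" using f by (simp add: preserves_def)
    also have "(\<lambda>X\<in>rect \<alpha>. f (map (\<lambda>g. g X) hs)) = (\<lambda>X\<in>rect \<alpha>. f' (map (\<lambda>g. g X) gs))"
    proof (rule restrict_ext)
      fix X assume X: "X \<in> rect \<alpha>"
      have "map (\<lambda>g. g X) hs = fill (map (map_option (\<lambda>g. g X)) (map (map_option (\<lambda>c. \<lambda>X\<in>rect \<alpha>. c)) ps))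
          (map (\<lambda>g. g X) (take t (drop u gs)))"
        unfolding hs_def using len t(1) by (intro map_fill) auto
      also have "map (map_option (\<lambda>g. g X)) (map (map_option (\<lambda>c. \<lambda>X\<in>rect \<alpha>. c)) ps) = ps"
        using X by (simp add: option.map_comp comp_def map_idI option.map_ident)
      also have "map (\<lambda>g. g X) (take t (drop u gs)) = take t (drop u (map (\<lambda>g. g X) gs))"
        by (simp add: take_map drop_map)
      finally have "map (\<lambda>g. g X) hs = fill ps (take t (drop u (map (\<lambda>g. g X) gs)))" .
      moreover have "map (\<lambda>g. g X) gs \<in> nlists d A"
        using gs sub X by (fastforce simp: nlists_def)
      ultimately show "f (map (\<lambda>g. g X) hs) = f' (map (\<lambda>g. g X) gs)"
        by (simp add: f'_def)
    qed
    finally show "(\<lambda>X\<in>rect \<alpha>. f' (map (\<lambda>g. g X) gs)) \<in> \<rho>" .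
  qed
qed

text \<open>The operands satisfying \<open>P\<close> are absorbed as constants into a translation
  \<open>f'\<close> of \<open>f\<close>, whose variables stand for the at most \<open>d\<close>
  other operands.\<close>

lemma compose_few_nonconstant:
  assumes trl: "\<And>f'. f' \<in> trl A K d n f \<Longrightarrow> preserves d f' \<alpha> \<rho>"
    and sub: "\<rho> \<subseteq> rect \<alpha> \<rightarrow>\<^sub>E A" and "n \<ge> 1"
    and h: "\<And>k. k < n \<Longrightarrow> h k \<in> \<rho>"
    and const: "\<And>k. k < n \<Longrightarrow> P k \<Longrightarrow> c k \<in> K \<and> (\<forall>X\<in>rect \<alpha>. h k X = c k)"
    and few: "card {k. k < n \<and> \<not> P k} \<le> d"
  shows "(\<lambda>X\<in>rect \<alpha>. f (map (\<lambda>k. h k X) [0..<n])) \<in> \<rho>"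
proof -
  define ps where "ps = map (\<lambda>k. if P k then Some (c k) else None) [0..<n]"
  define ks where "ks = filter (\<lambda>k. \<not> P k) [0..<n]"
  define t where "t = count_list ps None"
  \<comment> \<open>\<open>f'\<close> has \<open>u = 0\<close> and \<open>d - t\<close> fictitious
    variables at the end. They may receive any member of \<rho>; \<open>h 0\<close> is one since
    \<open>n \<ge> 1\<close>.\<close>
  define gs where "gs = map h ks @ replicate (d - t) (h 0)"
  define f' where "f' = (\<lambda>xs\<in>nlists d A. f (fill ps (take t (drop 0 xs))))"
  have t: "t = length ks" unfolding t_def ps_def ks_def by (rule count_list_filter)
  also have "\<dots> = card (set ks)" by (rule distinct_card[symmetric]) (simp add: ks_def)
  also have "set ks = {k. k < n \<and> \<not> P k}" by (auto simp: ks_def)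
  finally have "t \<le> d" using few by simp
  have "ps \<in> nlists n (insert None (Some ` K))"
    using const by (auto simp: ps_def nlists_def)
  then have "f' \<in> trl A K d n f"
    unfolding trl_def f'_def using \<open>t \<le> d\<close>
    by (intro CollectI exI[of _ ps] exI[of _ 0] exI[of _ t] exI[of _ "d - t"]) (auto simp: t_def)
  then have "preserves d f' \<alpha> \<rho>" by (rule trl)
  moreover have gs: "gs \<in> nlists d \<rho>"
    using h \<open>n \<ge> 1\<close> \<open>t \<le> d\<close> by (auto simp: gs_def nlists_def t ks_def)
  ultimately have "(\<lambda>X\<in>rect \<alpha>. f' (map (\<lambda>g. g X) gs)) \<in> \<rho>" by (simp add: preserves_def)
  also have "(\<lambda>X\<in>rect \<alpha>. f' (map (\<lambda>g. g X) gs)) = (\<lambda>X\<in>rect \<alpha>. f (map (\<lambda>k. h k X) [0..<n]))"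
  proof (rule restrict_ext)
    fix X assume X: "X \<in> rect \<alpha>"
    then have "map (\<lambda>g. g X) gs \<in> nlists d A"
      using gs sub by (fastforce simp: nlists_def)
    then have "f' (map (\<lambda>g. g X) gs) = f (fill ps (map (\<lambda>k. h k X) ks))"
      by (simp add: f'_def gs_def t comp_def)
    also have "fill ps (map (\<lambda>k. h k X) ks) = map (\<lambda>k. if P k then c k else h k X) [0..<n]"
      unfolding ps_def ks_def by (rule fill_filter)
    also have "\<dots> = map (\<lambda>k. h k X) [0..<n]" using const X by simp
    finally show "f' (map (\<lambda>g. g X) gs) = f (map (\<lambda>k. h k X) [0..<n])" .
  qed
  finally show ?thesis .
qed

text \<open>The \<open>n\<close> windows of length \<open>d\<close> cut the list into disjoint
  pieces. This bounds the total number of variables in the operands.\<close>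

lemma count_list_windows:
  "length xs = n * d \<Longrightarrow> (\<Sum>k<n. count_list (take d (drop (k * d) xs)) x) = count_list xs x"
proof (induction n arbitrary: xs)
  case (Suc n)
  have "(\<Sum>k<Suc n. count_list (take d (drop (k * d) xs)) x) =
      count_list (take d xs) x + (\<Sum>k<n. count_list (take d (drop (k * d) (drop d xs))) x)"
    by (simp add: sum.lessThan_Suc_shift add.commute del: sum.lessThan_Suc)
  also have "\<dots> = count_list (take d xs @ drop d xs) x" using Suc.IH[of "drop d xs"] Suc.prems by (simp only: count_list_append) simp
  finally show ?case by simp
qed simp

text \<open>
  Each argument tuple \<open>X\<^sub>j\<close> is repeated \<open>n\<close> times, so that the \<open>k\<close>-th operand of \<open>f\<close> gets
  its own copies of all the variables. By transitivity it is enough to consider the case that only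
  \<open>d\<close> of the \<open>n * d\<close> variables are not replaced by constants, and then at most \<open>d\<close> of the operands
  are not constant.
\<close>
lemma preserves_if_trl_preserves:
  assumes refl: "internally_reflexive A \<alpha> \<rho>" and trans: "transitive A \<alpha> \<rho>"
    and sub: "\<rho> \<subseteq> rect \<alpha> \<rightarrow>\<^sub>E A"
    and nonempty: "\<And>j. j < length \<alpha> \<Longrightarrow> fst (\<alpha> ! j) \<noteq> {}"
    and K: "Im_rel \<alpha> \<rho> \<subseteq> K" and n: "n \<ge> 1"
    and trl: "\<And>f'. f' \<in> trl A K (dimension \<alpha>) n f \<Longrightarrow> preserves (dimension \<alpha>) f' \<alpha> \<rho>"
  shows "preserves n f \<alpha> \<rho>"
  unfolding preserves_def
proof
  fix gs assume gs: "gs \<in> nlists n \<rho>"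
  let ?d = "\<lambda>j. snd (\<alpha> ! j)"
  \<comment> \<open>\<open>V ! j\<close> is meant to have length \<open>n * ?d j\<close>; operand
    \<open>k\<close> reads its \<open>k\<close>-th window of length \<open>?d j\<close>.\<close>
  define H where "H V = f (map (\<lambda>k. (gs ! k) (map (\<lambda>j. take (?d j) (drop (k * ?d j) (V ! j)))
    [0..<length \<alpha>])) [0..<n])" for V
  have "(\<lambda>X\<in>rect \<alpha>. H (map (\<lambda>j. map (\<lambda>i. X ! j ! (i mod ?d j)) [0..<n * ?d j])
      [0..<length \<alpha>])) \<in> \<rho>"
  proof (rule transitive_periodic[OF trans sub nonempty])
    fix ps :: "nat \<Rightarrow> 'b option list"
    assume ps: "ps j \<in> patterns (n * ?d j) (?d j) (fst (\<alpha> ! j))" if "j < length \<alpha>" for j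
    \<comment> \<open>\<open>qs k j\<close> is the part of the pattern that operand \<open>k\<close>
      sees, and \<open>u k j\<close> counts the variables spent on earlier windows. As variables
      keep their order, those of one operand form a block, so internal reflexivity applies with
      offset \<open>u k j\<close>.\<close>
    define qs where "qs k j = take (?d j) (drop (k * ?d j) (ps j))" for k j
    define u where "u k j = count_list (take (k * ?d j) (ps j)) None" for k j
    define h where "h k = (\<lambda>X\<in>rect \<alpha>. (gs ! k) (map (\<lambda>j. fill (qs k j) (drop (u k j) (X ! j)))
      [0..<length \<alpha>]))" for k
    define P where "P k \<longleftrightarrow> (\<forall>j<length \<alpha>. count_list (qs k j) None = 0)" for k
    have qs: "qs k j \<in> patterns (?d j) (count_list (qs k j) None) (fst (\<alpha> ! j))"
      if "k < n" "j < length \<alpha>" for k j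
    proof -
      have "k * ?d j + ?d j \<le> n * ?d j"
        using that(1) mult_le_mono1[of "Suc k" n "?d j"] by simp
      moreover have "set (qs k j) \<subseteq> set (ps j)"
        unfolding qs_def by (meson order_trans set_drop_subset set_take_subset)
      ultimately show ?thesis
        using ps[OF that(2)] by (auto simp: patterns_iff qs_def)
    qed
    have u: "u k j + count_list (qs k j) None \<le> ?d j" if "j < length \<alpha>" for k j
    proof -
      have "ps j = take (k * ?d j) (ps j) @ qs k j @ drop (?d j) (drop (k * ?d j) (ps j))"
        by (simp only: qs_def append_take_drop_id)
      then have "count_list (ps j) None = u k j + count_list (qs k j) None +
          count_list (drop (?d j) (drop (k * ?d j) (ps j))) None"
        unfolding u_def by (metis add.assoc count_list_append)
      then show ?thesis using ps[OF that] by (simp add: patterns_iff)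
    qed
    have h: "h k \<in> \<rho>" if "k < n" for k
      unfolding h_def using gs that nlistsE_nth_in qs u
      by (intro internally_reflexive_fill[OF refl sub]) blast+
    \<comment> \<open>Any fixed point of \<open>rect \<alpha>\<close> will do: it serves to read off
      the values of the constant operands.\<close>
    define Z where "Z = map (\<lambda>(B, d). replicate d (SOME b. b \<in> B)) \<alpha>"
    have Z: "Z \<in> rect \<alpha>"
      using nonempty by (auto simp: Z_def rect_iff nlists_def case_prod_beta some_in_eq)
    have "(\<lambda>X\<in>rect \<alpha>. f (map (\<lambda>k. h k X) [0..<n])) \<in> \<rho>"
    proof (rule compose_few_nonconstant[OF trl sub n h, where P = P and c = "\<lambda>k. h k Z"])
      fix k assume k: "k < n" "P k"
      have "h k Z \<in> K" using h[OF k(1)] Z K by (auto simp: Im_rel_def)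
      moreover have "h k X = h k Z" if "X \<in> rect \<alpha>" for X
      proof -
        have "fill (qs k j) (drop (u k j) (X ! j)) = fill (qs k j) (drop (u k j) (Z ! j))"
          if "j < length \<alpha>" for j
          using k(2) that unfolding P_def by (intro fill_no_variable) blast
        then have "map (\<lambda>j. fill (qs k j) (drop (u k j) (X ! j))) [0..<length \<alpha>] =
            map (\<lambda>j. fill (qs k j) (drop (u k j) (Z ! j))) [0..<length \<alpha>]"
          by simp
        then show ?thesis using that Z by (simp only: h_def restrict_apply if_True)
      qed
      ultimately show "h k Z \<in> K \<and> (\<forall>X\<in>rect \<alpha>. h k X = h k Z)" by blast
    next
      \<comment> \<open>Double counting: every operand outside \<open>P\<close> contains a variable,
        and factor \<open>j\<close> has only \<open>?d j\<close> variables, spread over the disjoint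
        windows.\<close>
      have "card {k. k < n \<and> \<not> P k} = (\<Sum>k | k < n \<and> \<not> P k. 1)" by simp
      also have "\<dots> \<le> (\<Sum>k | k < n \<and> \<not> P k. \<Sum>j<length \<alpha>. count_list (qs k j) None)"
      proof (rule sum_mono)
        fix k assume "k \<in> {k. k < n \<and> \<not> P k}"
        then obtain j where "j < length \<alpha>" "count_list (qs k j) None \<noteq> 0"
          unfolding P_def by blast
        then show "1 \<le> (\<Sum>j<length \<alpha>. count_list (qs k j) None)"
          using member_le_sum[of j "{..<length \<alpha>}" "\<lambda>j. count_list (qs k j) None"] by simp
      qed
      also have "\<dots> \<le> (\<Sum>k<n. \<Sum>j<length \<alpha>. count_list (qs k j) None)"
        by (rule sum_mono2) auto
      also have "\<dots> = (\<Sum>j<length \<alpha>. \<Sum>k<n. count_list (qs k j) None)" by (rule sum.swap)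
      also have "\<dots> = (\<Sum>j<length \<alpha>. ?d j)"
        unfolding qs_def using ps by (intro sum.cong) (auto simp: patterns_iff count_list_windows)
      also have "\<dots> = dimension \<alpha>"
        by (simp add: dimension_def sum_list_sum_nth atLeast0LessThan)
      finally show "card {k. k < n \<and> \<not> P k} \<le> dimension \<alpha>" .
    qed
    also have "(\<lambda>X\<in>rect \<alpha>. f (map (\<lambda>k. h k X) [0..<n])) =
        (\<lambda>X\<in>rect \<alpha>. H (map (\<lambda>j. fill (ps j) (X ! j)) [0..<length \<alpha>]))"
      unfolding H_def h_def qs_def u_def
      by (intro restrict_ext)
        (auto simp: take_fill drop_fill intro!: arg_cong[of _ _ f] arg_cong[of _ _ "(!) _ _"])
    finally show "(\<lambda>X\<in>rect \<alpha>. H (map (\<lambda>j. fill (ps j) (X ! j)) [0..<length \<alpha>])) \<in> \<rho>" .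
  qed (use n in auto)
  also have "(\<lambda>X\<in>rect \<alpha>. H (map (\<lambda>j. map (\<lambda>i. X ! j ! (i mod ?d j)) [0..<n * ?d j])
      [0..<length \<alpha>])) = (\<lambda>X\<in>rect \<alpha>. f (map (\<lambda>g. g X) gs))"
  proof (rule restrict_ext)
    fix X assume X: "X \<in> rect \<alpha>"
    \<comment> \<open>Windows start at multiples of the period \<open>?d j\<close>, so each of them
      shows \<open>X ! j\<close> itself.\<close>
    have window: "take (?d j) (drop (k * ?d j) (map (\<lambda>i. X ! j ! (i mod ?d j)) [0..<n * ?d j])) = X ! j"
      if "k < n" "j < length \<alpha>" for k j
    proof -
      have "k * ?d j + ?d j \<le> n * ?d j"
        using that(1) mult_le_mono1[of "Suc k" n "?d j"] by simp
      then show ?thesis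
        using X that by (intro nth_equalityI) (auto simp: rect_iff nlists_def)
    qed
    have "map (\<lambda>k. (gs ! k) (map (\<lambda>j. take (?d j) (drop (k * ?d j)
        (map (\<lambda>j. map (\<lambda>i. X ! j ! (i mod ?d j)) [0..<n * ?d j]) [0..<length \<alpha>] ! j)))
        [0..<length \<alpha>])) [0..<n] = map (\<lambda>k. (gs ! k) X) [0..<n]"
    proof (rule map_cong[OF HOL.refl])
      fix k assume k: "k \<in> set [0..<n]"
      have "map (\<lambda>j. take (?d j) (drop (k * ?d j)
        (map (\<lambda>j. map (\<lambda>i. X ! j ! (i mod ?d j)) [0..<n * ?d j]) [0..<length \<alpha>] ! j)))
        [0..<length \<alpha>] = X"
        using X k window by (intro nth_equalityI) (auto simp: rect_iff)
      then show "(gs ! k) (map (\<lambda>j. take (?d j) (drop (k * ?d j)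
        (map (\<lambda>j. map (\<lambda>i. X ! j ! (i mod ?d j)) [0..<n * ?d j]) [0..<length \<alpha>] ! j)))
        [0..<length \<alpha>]) = (gs ! k) X" by (rule arg_cong)
    qed
    also have "\<dots> = map (\<lambda>g. g X) gs"
      using gs by (intro nth_equalityI) (auto simp: nlists_def)
    finally show "H (map (\<lambda>j. map (\<lambda>i. X ! j ! (i mod ?d j)) [0..<n * ?d j]) [0..<length \<alpha>]) =
        f (map (\<lambda>g. g X) gs)"
      unfolding H_def by (rule arg_cong)
  qed
  finally show "(\<lambda>X\<in>rect \<alpha>. f (map (\<lambda>g. g X) gs)) \<in> \<rho>" .
qed

theorem theorem6p9:
  fixes A :: "'a set" and \<alpha> :: "'b arity" and \<rho> :: "('b list list \<Rightarrow> 'a) set"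
  assumes "finite A" and "A \<noteq> {}"
    and "\<alpha> \<noteq> []"
    and "\<forall>(B, d)\<in>set \<alpha>. finite B \<and> B \<noteq> {}"
    and "\<rho> \<subseteq> rect \<alpha> \<rightarrow>\<^sub>E A"
  shows "(weak_generalized_quasiorder A \<alpha> \<rho> \<longrightarrow> Xi_w A \<alpha> (dimension \<alpha>) \<rho>) \<and>
         (generalized_quasiorder A \<alpha> \<rho> \<longrightarrow> Xi A \<alpha> (dimension \<alpha>) \<rho>)"
proof -
  have nonempty: "fst (\<alpha> ! j) \<noteq> {}" if "j < length \<alpha>" for j
    using assms(4) nth_mem[OF that] by (metis (mono_tags, lifting) case_prod_beta)
  \<comment> \<open>Both claims are one equivalence for a set \<open>K\<close> of constants that
    contains Im \<rho> and whose constant functions lie in \<rho>: \<open>K\<close> is Im \<rho> in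
    the weak case and \<open>A\<close> in the reflexive case.\<close>
  have iff: "preserves n f \<alpha> \<rho> \<longleftrightarrow>
      (\<forall>f'\<in>trl A K (dimension \<alpha>) n f. preserves (dimension \<alpha>) f' \<alpha> \<rho>)"
    if "internally_reflexive A \<alpha> \<rho>" "transitive A \<alpha> \<rho>" "n \<ge> 1" "Im_rel \<alpha> \<rho> \<subseteq> K"
      "\<And>c. c \<in> K \<Longrightarrow> (\<lambda>X\<in>rect \<alpha>. c) \<in> \<rho>" for n f K
    using preserves_trl[OF _ assms(5) that(5)]
      preserves_if_trl_preserves[OF that(1,2) assms(5) nonempty that(4,3)]
    by blast
  have "Xi_w A \<alpha> (dimension \<alpha>) \<rho>" if "weak_generalized_quasiorder A \<alpha> \<rho>"
    using that iff[OF _ _ _ order_refl constant_in_relation[OF _ assms(5)]]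
    unfolding Xi_w_def weak_generalized_quasiorder_def by blast
  moreover have "Xi A \<alpha> (dimension \<alpha>) \<rho>" if "generalized_quasiorder A \<alpha> \<rho>"
  proof -
    have "Im_rel \<alpha> \<rho> \<subseteq> A" using assms(5) by (auto simp: Im_rel_def)
    then show ?thesis
      using that iff[of _ A]
      unfolding Xi_def generalized_quasiorder_def reflexive_def by blast
  qed
  ultimately show ?thesis by blast
qed

end
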